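(* Assume (A1)–(A3) for problem (DC) and that $\theta$ is coercive on $\Xi$ (i.e., $\theta(\mathbf x)\to+\infty$ as $\|\mathbf x\|\to\infty$ with $\mathbf x\in\Xi$). Let $\boldsymbol\tau\ge\mathbf 0$ with $c_{\boldsymbol\tau}>0$. Consider Algorithm 2: given $\mathbf x^0\in\Xi$, step sizes $\{\gamma^\nu\}$ and accuracies $\{\varepsilon^\nu\}$ with $\varepsilon^\nu\downarrow0$, at each $\nu$ pick $\mathbf z^\nu\in\Xi$ with $\|\mathbf z^\nu-\hat{\mathbf x}(\mathbf x^\nu)\|\le\varepsilon^\nu$ and set $\mathbf x^{\nu+1}=\mathbf x^\nu+\gamma^\nu(\mathbf z^\nu-\mathbf x^\nu)$. Suppose (i) $\gamma^\nu\in(0,1]$; (ii) $\gamma^\nu\to0$; (iii) $\sum_\nu\gamma^\nu=+\infty$; (iv) $\sum_\nu(\gamma^\nu)^2<+\infty$; (v) $\sum_\nu\varepsilon^\nu\gamma^\nu<+\infty$. Then either $\mathbf x^\nu$ is a stationary point of (DC) for some finite $\nu$, or $\{\mathbf x^\nu\}$ has at least one limit point and every limit point is a stationary point of (DC).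
   Context: Let $I\ge1$, $n_1,\dots,n_I\ge1$, $n=\sum_i n_i$. Vectors $\mathbf x\in\mathbb R^n$ are partitioned as $\mathbf x=(\mathbf x_i)_{i=1}^I$, $\mathbf x_i\in\mathbb R^{n_i}$; $\mathbf x_{-i}=(\mathbf x_j)_{j\ne i}$, and $(\mathbf x_i,\mathbf y_{-i})$ is the vector with $i$-th block $\mathbf x_i$ and $j$-th block $\mathbf y_j$ for $j\neq i$. Given sets $\mathcal X_i\subseteq\mathbb R^{n_i}$, functions $f_i,g_i:\mathbb R^n\to\mathbb R$ and $\mathbf h=(h_1,\dots,h_{n_c}):\mathbb R^n\to\mathbb R^{n_c}$, problem (DC) is: minimize $\theta(\mathbf x)=\sum_{i=1}^I(f_i(\mathbf x)-g_i(\mathbf x))$ subject to $\mathbf x_i\in\mathcal X_i$ for all $i$ and $\mathbf h(\mathbf x)\le\mathbf 0$. Let $\mathcal X=\prod_i\mathcal X_i$, $\mathcal X_{-i}=\prod_{j\ne i}\mathcal X_j$, $\Xi=\{\mathbf x\in\mathcal X:\mathbf h(\mathbf x)\le\mathbf 0\}$, assumed nonempty. Assumptions: (A1) each $f_i,g_i,h_j$ is convex and continuously differentiable on an open set containing $\mathcal X$; (A2) each $\mathcal X_i$ is nonempty, closed, convex; (A3) $\nabla f_i$, $\nabla g_i$ are Lipschitz continuous on $\mathcal X$. A stationary point of (DC) is $\mathbf x^\star\in\Xi$ with $\nabla\theta(\mathbf x^\star)^T(\mathbf y-\mathbf x^\star)\ge0$ for all $\mathbf y\in\Xi$. For each $i$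 and $\mathbf x_{-i}\in\mathcal X_{-i}$, $c_{f_i}(\mathbf x_{-i})\ge0$ is the largest constant such that $(\mathbf z_i-\mathbf w_i)^T(\nabla_{\mathbf x_i}f_i(\mathbf z_i,\mathbf x_{-i})-\nabla_{\mathbf x_i}f_i(\mathbf w_i,\mathbf x_{-i}))\ge c_{f_i}(\mathbf x_{-i})\|\mathbf z_i-\mathbf w_i\|^2$ for all $\mathbf z_i,\mathbf w_i\in\mathcal X_i$. For $\boldsymbol\tau\ge\mathbf 0$, $c_{\boldsymbol\tau}:=\min_{i}\{\tau_i+\inf_{\mathbf z_{-i}\in\mathcal X_{-i}}c_{f_i}(\mathbf z_{-i})\}$. For $\mathbf y\in\mathcal X$ let $\tilde\theta(\mathbf x;\mathbf y)=\sum_i\tilde\theta_i(\mathbf x_i;\mathbf y)$ with $\tilde\theta_i(\mathbf x_i;\mathbf y)=f_i(\mathbf x_i,\mathbf y_{-i})+\sum_{j\ne i}\nabla_{\mathbf x_i}f_j(\mathbf y)^T(\mathbf x_i-\mathbf y_i)-g_i(\mathbf y)-\sum_{j=1}^I\nabla_{\mathbf x_i}g_j(\mathbf y)^T(\mathbf x_i-\mathbf y_i)+\tfrac{\tau_i}{2}\|\mathbf x_i-\mathbf y_i\|^2.$ When $c_{\boldsymbol\tau}>0$, $\hat{\mathbf x}(\mathbf y):=\arg\min_{\mathbf x\in\Xi}\tilde\theta(\mathbf x;\mathbf y)$ (the unique minimizer). *)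

theory Defs
  imports "HOL-Analysis.Analysis"
begin

text \<open>Block structure: the coordinates of \<open>real^'n\<close> are partitioned into blocks by
  \<open>blk :: 'n \<Rightarrow> 'b\<close>; block \<open>i\<close> is \<open>{k. blk k = i}\<close>.  A block vector \<open>x_i \<in> R^{n_i}\<close> is
  represented by its embedding in \<open>real^'n\<close> (zero outside block \<open>i\<close>).\<close>

definition blockproj :: "('n \<Rightarrow> 'b) \<Rightarrow> 'b \<Rightarrow> real^'n \<Rightarrow> real^'n" where
  "blockproj blk i x = (\<chi> k. if blk k = i then x $ k else 0)"

definition block_space :: "('n \<Rightarrow> 'b) \<Rightarrow> 'b \<Rightarrow> (real^'n) set" where
  "block_space blk i = {v. \<forall>k. blk k \<noteq> i \<longrightarrow> v $ k = 0}"

definition blend :: "('n \<Rightarrow> 'b) \<Rightarrow> 'b \<Rightarrow> real^'n \<Rightarrow> real^'n \<Rightarrow> real^'n" where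
  "blend blk i x y = blockproj blk i x + (y - blockproj blk i y)"

definition Xprod :: "('n \<Rightarrow> 'b) \<Rightarrow> ('b \<Rightarrow> (real^'n) set) \<Rightarrow> (real^'n) set" where
  "Xprod blk Xs = {x. \<forall>i. blockproj blk i x \<in> Xs i}"

definition Xi_set :: "('n \<Rightarrow> 'b) \<Rightarrow> ('b \<Rightarrow> (real^'n) set) \<Rightarrow> nat \<Rightarrow> (nat \<Rightarrow> real^'n \<Rightarrow> real)
    \<Rightarrow> (real^'n) set" where
  "Xi_set blk Xs nc h = {x \<in> Xprod blk Xs. \<forall>j<nc. h j x \<le> 0}"

definition stationary :: "(real^'n) set \<Rightarrow> (real^'n \<Rightarrow> real^'n) \<Rightarrow> real^'n \<Rightarrow> bool" where
  "stationary Xi Dtheta xs \<longleftrightarrow> xs \<in> Xi \<and> (\<forall>y\<in>Xi. Dtheta xs \<bullet> (y - xs) \<ge> 0)"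

text \<open>\<open>c_{f_i}(z_{-i})\<close>: largest constant \<open>c \<ge> 0\<close> with the strong monotonicity inequality
  (as an extended real, \<open>\<infinity>\<close> if every \<open>c\<close> works, e.g. \<open>\<X>_i\<close> a singleton).
  Only the blocks \<open>j \<noteq> i\<close> of \<open>z\<close> matter.\<close>
definition c_f :: "('n \<Rightarrow> 'b) \<Rightarrow> ('b \<Rightarrow> (real^'n) set) \<Rightarrow> ('b \<Rightarrow> real^'n \<Rightarrow> real^'n)
    \<Rightarrow> 'b \<Rightarrow> real^'n \<Rightarrow> ereal" where
  "c_f blk Xs Df i z = Sup {ereal c | c. c \<ge> 0 \<and>
     (\<forall>a\<in>Xs i. \<forall>b\<in>Xs i. (a - b) \<bullet> (blockproj blk i (Df i (blend blk i a z))
                                   - blockproj blk i (Df i (blend blk i b z))) \<ge> c * (norm (a - b))\<^sup>2)}"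

text \<open>\<open>c_\<tau> = min_i (\<tau>_i + inf_{z_{-i} \<in> \<X>_{-i}} c_{f_i}(z_{-i}))\<close>; \<open>z\<close> ranges over \<open>\<X>\<close>
  (each \<open>\<X>_i\<close> is nonempty, so the \<open>-i\<close> parts of \<open>\<X>\<close> are exactly \<open>\<X>_{-i}\<close>).\<close>
definition c_tau :: "('n \<Rightarrow> 'b::finite) \<Rightarrow> ('b \<Rightarrow> (real^'n) set) \<Rightarrow> ('b \<Rightarrow> real^'n \<Rightarrow> real^'n)
    \<Rightarrow> ('b \<Rightarrow> real) \<Rightarrow> ereal" where
  "c_tau blk Xs Df tau = Min (range (\<lambda>i. ereal (tau i) + (INF z\<in>Xprod blk Xs. c_f blk Xs Df i z)))"

definition theta_tilde :: "('n \<Rightarrow> 'b::finite) \<Rightarrow> ('b \<Rightarrow> real^'n \<Rightarrow> real) \<Rightarrow> ('b \<Rightarrow> real^'n \<Rightarrow> real)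
    \<Rightarrow> ('b \<Rightarrow> real^'n \<Rightarrow> real^'n) \<Rightarrow> ('b \<Rightarrow> real^'n \<Rightarrow> real^'n) \<Rightarrow> ('b \<Rightarrow> real)
    \<Rightarrow> real^'n \<Rightarrow> real^'n \<Rightarrow> real" where
  "theta_tilde blk f g Df Dg tau x y =
     (\<Sum>i\<in>UNIV.
        f i (blend blk i x y)
      + (\<Sum>j\<in>UNIV - {i}. blockproj blk i (Df j y) \<bullet> (blockproj blk i x - blockproj blk i y))
      - g i y
      - (\<Sum>j\<in>UNIV. blockproj blk i (Dg j y) \<bullet> (blockproj blk i x - blockproj blk i y))
      + tau i / 2 * (norm (blockproj blk i x - blockproj blk i y))\<^sup>2)"

definition xhat :: "(real^'n) set \<Rightarrow> (real^'n \<Rightarrow> real^'n \<Rightarrow> real) \<Rightarrow> real^'n \<Rightarrow> real^'n" where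
  "xhat Xi tt y = (THE x. x \<in> Xi \<and> (\<forall>w\<in>Xi. tt x y \<le> tt w y))"

definition seq_limit_point :: "(nat \<Rightarrow> 'a::topological_space) \<Rightarrow> 'a \<Rightarrow> bool" where
  "seq_limit_point x l \<longleftrightarrow> (\<exists>r. strict_mono r \<and> (x \<circ> r) \<longlonglongrightarrow> l)"

end

theory Submission
  imports Defs
begin

text \<open>
  Let \<open>p(y)\<close> be the exact surrogate minimizer. A descent argument for \<open>\<theta>\<close> along the iterates \<open>x\<^sub>n\<close>
  themselves produces error terms \<open>\<gamma>\<^sub>n \<epsilon>\<^sub>n \<parallel>\<nabla>\<theta>(x\<^sub>n)\<parallel>\<close>, which cannot be controlled before \<open>x\<^sub>n\<close> is
  known to be bounded. Instead, use the shadow sequence \<open>y\<^sub>0 = x\<^sub>0\<close>,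
  \<open>y\<^sub>n\<^sub>+\<^sub>1 = (1 - \<gamma>\<^sub>n) y\<^sub>n + \<gamma>\<^sub>n p(x\<^sub>n)\<close>, which stays feasible. The distances \<open>d\<^sub>n = \<parallel>x\<^sub>n - y\<^sub>n\<parallel>\<close> satisfy
  \<open>d\<^sub>n\<^sub>+\<^sub>1 \<le> (1 - \<gamma>\<^sub>n) d\<^sub>n + \<gamma>\<^sub>n \<epsilon>\<^sub>n\<close>, so they are bounded and \<open>\<Sum> \<gamma>\<^sub>n d\<^sub>n < \<infinity>\<close>. The variational inequality
  at \<open>p(x\<^sub>n)\<close>, tested with \<open>y\<^sub>n\<close>, gives
  \<open>\<nabla>\<theta>(y\<^sub>n) \<bullet> (p(x\<^sub>n) - y\<^sub>n) \<le> - c \<parallel>p(x\<^sub>n) - y\<^sub>n\<parallel>\<^sup>2 + K d\<^sub>n \<parallel>p(x\<^sub>n) - y\<^sub>n\<parallel>\<close>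
  with no gradient norm on the right. Hence \<open>\<theta>(y\<^sub>n)\<close> decreases up to a summable error, coercivity
  bounds \<open>y\<^sub>n\<close> and thus \<open>x\<^sub>n\<close>, and \<open>\<Sum> \<gamma>\<^sub>n q\<^sub>n\<^sup>2 < \<infinity>\<close> for \<open>q\<^sub>n = \<parallel>p(x\<^sub>n) - x\<^sub>n\<parallel>\<close>. Since \<open>p\<close> is Lipschitz,
  \<open>q\<^sub>n\<^sup>2\<close> has summable variation, so \<open>q\<^sub>n \<longlonglongrightarrow> 0\<close> because \<open>\<Sum> \<gamma>\<^sub>n = \<infinity>\<close>; limit points are therefore fixed
  points of \<open>p\<close>, which are stationary.
\<close>

section \<open>First-order inequalities and minimizers for monotone gradients\<close>

text \<open>On the segment from \<open>x\<close> to \<open>w\<close>, the gap between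
  \<open>F\<close> and its quadratic model has nonnegative derivative. The sign of \<open>c\<close>
  is free: \<open>c > 0\<close> gives quadratic growth, while \<open>-F\<close> with
  \<open>c = - L\<close> gives the descent inequality for an \<open>L\<close>-Lipschitz
  gradient.\<close>

lemma lower_bound_of_monotone_gradient:
  fixes F :: "'a::euclidean_space \<Rightarrow> real"
  assumes S: "convex S"
    and deriv: "\<And>x. x \<in> S \<Longrightarrow> (F has_derivative (\<lambda>v. G x \<bullet> v)) (at x)"
    and mono: "\<And>x w. x \<in> S \<Longrightarrow> w \<in> S \<Longrightarrow> c * (norm (x - w))\<^sup>2 \<le> (G x - G w) \<bullet> (x - w)"
    and x: "x \<in> S" and w: "w \<in> S"
  shows "F x + G x \<bullet> (w - x) + c / 2 * (norm (w - x))\<^sup>2 \<le> F w"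
proof -
  define d where "d = w - x"
  define \<phi> where "\<phi> t = F (x + t *\<^sub>R d) - t * (G x \<bullet> d) - c / 2 * t\<^sup>2 * (norm d)\<^sup>2" for t
  have seg: "x + t *\<^sub>R d \<in> S" if "0 \<le> t" "t \<le> 1" for t
    using convexD_alt[OF S x w that] by (simp add: d_def algebra_simps)
  have "\<phi> 0 \<le> \<phi> 1"
  proof (rule DERIV_nonneg_imp_nondecreasing[of 0 1 \<phi>])
    fix t :: real assume t: "0 \<le> t" "t \<le> 1"
    have inner: "((\<lambda>t. x + t *\<^sub>R d) has_derivative (\<lambda>u. u *\<^sub>R d)) (at t)"
      by (auto intro!: derivative_eq_intros)
    have "((\<lambda>t. F (x + t *\<^sub>R d)) has_derivative (\<lambda>u. G (x + t *\<^sub>R d) \<bullet> (u *\<^sub>R d))) (at t)"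
      by (rule has_derivative_compose[OF inner deriv[OF seg[OF t]]])
    then have F: "((\<lambda>t. F (x + t *\<^sub>R d)) has_real_derivative G (x + t *\<^sub>R d) \<bullet> d) (at t)"
      by (rule has_derivative_imp_has_field_derivative) simp
    have "(\<phi> has_real_derivative G (x + t *\<^sub>R d) \<bullet> d - G x \<bullet> d - c * t * (norm d)\<^sup>2) (at t)"
      unfolding \<phi>_def[abs_def] by (rule derivative_eq_intros F refl | simp)+
    moreover have "G (x + t *\<^sub>R d) \<bullet> d - G x \<bullet> d - c * t * (norm d)\<^sup>2 \<ge> 0"
    proof (cases "t = 0")
      case False
      \<comment> \<open>Monotonicity between \<open>x + t d\<close> and \<open>x\<close> carries an
        extra factor \<open>t\<close>, cancelled afterwards; hence the separate case
        \<open>t = 0\<close>.\<close>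
      have "t * (c * t * (norm d)\<^sup>2) \<le> t * (G (x + t *\<^sub>R d) \<bullet> d - G x \<bullet> d)"
        using mono[OF seg[OF t] x]
        by (simp add: power_mult_distrib inner_diff_left power2_eq_square mult_ac)
      then show ?thesis using False t by simp
    qed simp
    ultimately show "\<exists>y. (\<phi> has_real_derivative y) (at t) \<and> 0 \<le> y" by blast
  qed simp
  then show ?thesis by (simp add: \<phi>_def d_def)
qed

lemma gradient_variational_inequality:
  fixes F :: "'a::euclidean_space \<Rightarrow> real"
  assumes S: "convex S"
    and deriv: "(F has_derivative (\<lambda>v. G \<bullet> v)) (at x)"
    and x: "x \<in> S" and min: "\<And>w. w \<in> S \<Longrightarrow> F x \<le> F w" and w: "w \<in> S"
  shows "0 \<le> G \<bullet> (w - x)"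
proof (rule ccontr)
  assume neg: "\<not> 0 \<le> G \<bullet> (w - x)"
  have inner: "((\<lambda>t. x + t *\<^sub>R (w - x)) has_derivative (\<lambda>u. u *\<^sub>R (w - x))) (at 0)"
    by (auto intro!: derivative_eq_intros)
  have "((\<lambda>t. F (x + t *\<^sub>R (w - x))) has_derivative (\<lambda>u. G \<bullet> (u *\<^sub>R (w - x)))) (at 0)"
    by (rule has_derivative_compose[OF inner]) (simp add: deriv)
  then have "((\<lambda>t. F (x + t *\<^sub>R (w - x))) has_real_derivative G \<bullet> (w - x)) (at 0)"
    by (rule has_derivative_imp_has_field_derivative) simp
  from DERIV_neg_dec_right[OF this] neg obtain \<delta> where \<delta>: "\<delta> > 0"
    "\<And>h. 0 < h \<Longrightarrow> h < \<delta> \<Longrightarrow> F (x + h *\<^sub>R (w - x)) < F x"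
    by auto
  define h where "h = min 1 (\<delta> / 2)"
  have h: "0 < h" "h < \<delta>" "h \<le> 1" using \<delta>(1) by (auto simp: h_def)
  have "x + h *\<^sub>R (w - x) \<in> S"
    using convexD_alt[OF S x w, of h] h by (simp add: algebra_simps)
  with min \<delta>(2)[OF h(1,2)] show False by force
qed

text \<open>Quadratic growth confines the search to a compact ball, and the same growth at a
  minimizer, where the linear term is nonnegative, excludes a second one.\<close>

lemma strongly_monotone_gradient_ex1_minimizer:
  fixes F :: "'a::euclidean_space \<Rightarrow> real"
  assumes S: "convex S" "closed S" "S \<noteq> {}" and c: "c > 0"
    and deriv: "\<And>x. x \<in> S \<Longrightarrow> (F has_derivative (\<lambda>v. G x \<bullet> v)) (at x)"
    and mono: "\<And>x w. x \<in> S \<Longrightarrow> w \<in> S \<Longrightarrow> c * (norm (x - w))\<^sup>2 \<le> (G x - G w) \<bullet> (x - w)"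
  shows "\<exists>!x. x \<in> S \<and> (\<forall>w\<in>S. F x \<le> F w)"
proof -
  have lower: "F x + G x \<bullet> (w - x) + c / 2 * (norm (w - x))\<^sup>2 \<le> F w" if "x \<in> S" "w \<in> S" for x w
    using lower_bound_of_monotone_gradient[OF S(1) deriv mono that] .
  obtain a where a: "a \<in> S" using S(3) by blast
  \<comment> \<open>Beyond this radius \<open>c / 2 * (norm (w - a))\<^sup>2\<close> dominates the
    linear term, which is at least \<open>- norm (G a) * norm (w - a)\<close>.\<close>
  define R where "R = 2 * norm (G a) / c"
  have "R \<ge> 0" using c by (simp add: R_def)
  have far: "F a \<le> F w" if w: "w \<in> S" "norm (w - a) > R" for w
  proof -
    have "0 \<le> norm (w - a) * (c / 2 * norm (w - a) - norm (G a))"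
      using w(2) c by (intro mult_nonneg_nonneg) (auto simp: R_def field_simps)
    also have "\<dots> = c / 2 * (norm (w - a))\<^sup>2 - norm (G a) * norm (w - a)"
      by (simp add: power2_eq_square algebra_simps)
    also have "\<dots> \<le> c / 2 * (norm (w - a))\<^sup>2 + G a \<bullet> (w - a)"
      using Cauchy_Schwarz_ineq2[of "G a" "w - a"] by simp
    finally show ?thesis using lower[OF a w(1)] by simp
  qed
  have "continuous_on S F"
    using deriv by (meson continuous_at_imp_continuous_on has_derivative_continuous)
  then have "\<exists>x\<in>S \<inter> cball a R. \<forall>w\<in>S \<inter> cball a R. F x \<le> F w"
    using a \<open>R \<ge> 0\<close> S(2)
    by (intro continuous_attains_inf) (auto intro: continuous_on_subset closed_Int_compact)
  then obtain x where x: "x \<in> S" and xmin: "\<And>w. w \<in> S \<inter> cball a R \<Longrightarrow> F x \<le> F w" by blast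
  have "F x \<le> F a" using xmin[of a] a \<open>R \<ge> 0\<close> by simp
  have min: "F x \<le> F w" if "w \<in> S" for w
  proof (cases "norm (w - a) \<le> R")
    case True
    then show ?thesis using xmin that by (simp add: dist_norm norm_minus_commute)
  next
    case False
    then show ?thesis using far[OF that] \<open>F x \<le> F a\<close> by simp
  qed
  have "w = x" if w: "w \<in> S" "\<forall>v\<in>S. F w \<le> F v" for w
  proof -
    have "0 \<le> G x \<bullet> (w - x)"
      by (rule gradient_variational_inequality[OF S(1) deriv[OF x] x min w(1)])
    then have "c / 2 * (norm (w - x))\<^sup>2 \<le> 0" using lower[OF x w(1)] w(2) x by force
    then have "(norm (w - x))\<^sup>2 \<le> 0" using c by (simp add: mult_le_0_iff)
    then show ?thesis by simp
  qed
  then show ?thesis using x min by blast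
qed

section \<open>Real sequences with summable errors\<close>

text \<open>Summable variation forces convergence; a positive limit would eventually bound \<gamma>
  by a multiple of the summable weighted terms.\<close>

lemma tendsto_zero_of_weighted_summable:
  fixes s \<gamma> :: "nat \<Rightarrow> real"
  assumes s: "\<And>n. 0 \<le> s n" and \<gamma>: "\<And>n. 0 \<le> \<gamma> n" "\<not> summable \<gamma>"
    and weighted: "summable (\<lambda>n. \<gamma> n * s n)"
    and var: "summable (\<lambda>n. \<bar>s (Suc n) - s n\<bar>)"
  shows "s \<longlonglongrightarrow> 0"
proof -
  have "summable (\<lambda>n. s (Suc n) - s n)" using var by (rule summable_rabs_cancel)
  then have "(\<lambda>n. \<Sum>k<n. s (Suc k) - s k) \<longlonglongrightarrow> (\<Sum>n. s (Suc n) - s n)" by (rule summable_LIMSEQ)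
  then have "(\<lambda>n. s n - s 0) \<longlonglongrightarrow> (\<Sum>n. s (Suc n) - s n)" by (simp add: sum_lessThan_telescope)
  then have "(\<lambda>n. s n - s 0 + s 0) \<longlonglongrightarrow> (\<Sum>n. s (Suc n) - s n) + s 0" by (intro tendsto_intros)
  then obtain l where l: "s \<longlonglongrightarrow> l" by auto
  have "l \<ge> 0" using LIMSEQ_le_const[OF l] s by blast
  moreover have "\<not> l > 0"
  proof
    assume pos: "l > 0"
    then have "\<forall>\<^sub>F n in sequentially. l / 2 < s n" using order_tendstoD(1)[OF l, of "l/2"] by simp
    then have "\<forall>\<^sub>F n in sequentially. norm (\<gamma> n) \<le> 2 / l * (\<gamma> n * s n)"
    proof eventually_elim
      case (elim n)
      then have "\<gamma> n * (l / 2) \<le> \<gamma> n * s n" using \<gamma>(1) by (intro mult_left_mono) auto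
      then show ?case using pos \<gamma>(1)[of n] by (simp add: field_simps)
    qed
    then have "summable \<gamma>" by (rule summable_comparison_test_ev) (intro summable_mult weighted)
    with \<gamma>(2) show False by simp
  qed
  ultimately show ?thesis using l by simp
qed

text \<open>Telescoping from \<open>N\<close>, with every partial error sum at most
  \<open>suminf e\<close>. The offset \<open>N\<close> is there because descent of \<theta> holds
  only once the step sizes are small.\<close>

lemma quasi_descent:
  fixes a b e :: "nat \<Rightarrow> real"
  assumes step: "\<And>n. n \<ge> N \<Longrightarrow> a (Suc n) + b n \<le> a n + e n"
    and b: "\<And>n. 0 \<le> b n" and e: "\<And>n. 0 \<le> e n" "summable e" and a: "\<And>n. m \<le> a n"
  shows "\<And>n. n \<ge> N \<Longrightarrow> a n \<le> a N + suminf e" and "summable b"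
proof -
  have acc: "a (N + k) + (\<Sum>i<k. b (i + N)) \<le> a N + (\<Sum>i<k. e (i + N))" for k
  proof (induction k)
    case (Suc k)
    then show ?case using step[of "N + k"] by (simp add: add.commute)
  qed simp
  have e_le: "(\<Sum>i<k. e (i + N)) \<le> suminf e" for k
  proof -
    have "(\<Sum>i<k. e (i + N)) = (\<Sum>i\<in>{N..<k+N}. e i)"
      using sum.shift_bounds_nat_ivl[of e 0 N k] by (simp add: lessThan_atLeast0)
    also have "\<dots> \<le> suminf e" by (rule sum_le_suminf) (use e in auto)
    finally show ?thesis .
  qed
  show "a n \<le> a N + suminf e" if "n \<ge> N" for n
    using acc[of "n - N"] e_le[of "n - N"] sum_nonneg[of "{..<n-N}" "\<lambda>i. b (i + N)"] b that by simp
  have "summable (\<lambda>i. b (i + N))"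
  proof (rule summableI_nonneg_bounded)
    show "(\<Sum>i<k. b (i + N)) \<le> a N + suminf e - m" for k
      using acc[of k] e_le[of k] a[of "N + k"] by simp
  qed (rule b)
  then show "summable b" by (simp add: summable_iff_shift)
qed

text \<open>Moving \<open>\<gamma> n * d n\<close> to the left turns the recursion into
  quasi-descent with that term as the decrease and lower bound 0.\<close>

lemma summable_contraction_error:
  fixes d \<gamma> e :: "nat \<Rightarrow> real"
  assumes d: "\<And>n. 0 \<le> d n" and \<gamma>: "\<And>n. 0 \<le> \<gamma> n" and e: "\<And>n. 0 \<le> e n" "summable e"
    and step: "\<And>n. d (Suc n) \<le> (1 - \<gamma> n) * d n + e n"
  shows "\<And>n. d n \<le> d 0 + suminf e" and "summable (\<lambda>n. \<gamma> n * d n)"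
  using quasi_descent[of 0 d "\<lambda>n. \<gamma> n * d n" e 0] assms by (auto simp: algebra_simps)

section \<open>Inexact iteration of an abstract surrogate map\<close>

text \<open>\<open>G u y\<close> plays the role of the gradient at \<open>u\<close> of the surrogate built at \<open>y\<close>, and \<open>p y\<close> that
  of its constrained minimizer.\<close>

locale surrogate_map =
  fixes S :: "'a::euclidean_space set" and G :: "'a \<Rightarrow> 'a \<Rightarrow> 'a" and p :: "'a \<Rightarrow> 'a"
    and c K :: real
  assumes S_convex: "convex S" and S_closed: "closed S"
    and c_pos: "c > 0" and K_nonneg: "K \<ge> 0"
    and G_mono: "\<And>u w y. u \<in> S \<Longrightarrow> w \<in> S \<Longrightarrow> y \<in> S
        \<Longrightarrow> c * (norm (u - w))\<^sup>2 \<le> (G u y - G w y) \<bullet> (u - w)"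
    and G_lip: "\<And>u y w. u \<in> S \<Longrightarrow> y \<in> S \<Longrightarrow> w \<in> S \<Longrightarrow> norm (G u y - G u w) \<le> K * norm (y - w)"
    and p_in: "\<And>y. y \<in> S \<Longrightarrow> p y \<in> S"
    and p_vi: "\<And>y w. y \<in> S \<Longrightarrow> w \<in> S \<Longrightarrow> 0 \<le> G (p y) y \<bullet> (w - p y)"
begin

text \<open>Three contributions: changing the base point from \<open>x\<close> to \<open>y\<close>
  costs the Lipschitz term, strong monotonicity gives the decrease, and the variational inequality
  at \<open>p x\<close> tested with \<open>y\<close> disposes of the rest.\<close>

lemma descent_direction:
  assumes x: "x \<in> S" and y: "y \<in> S"
  shows "G y y \<bullet> (p x - y) \<le> - c * (norm (p x - y))\<^sup>2 + K * norm (x - y) * norm (p x - y)"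
proof -
  have "G y y \<bullet> (p x - y) = (G y y - G y x) \<bullet> (p x - y) - (G (p x) x - G y x) \<bullet> (p x - y)
      - G (p x) x \<bullet> (y - p x)"
    by (simp add: algebra_simps)
  moreover have "(G y y - G y x) \<bullet> (p x - y) \<le> K * norm (x - y) * norm (p x - y)"
  proof -
    have "(G y y - G y x) \<bullet> (p x - y) \<le> norm (G y y - G y x) * norm (p x - y)"
      by (rule norm_cauchy_schwarz)
    also have "\<dots> \<le> K * norm (x - y) * norm (p x - y)"
      using G_lip[OF y y x] by (intro mult_right_mono) (auto simp: norm_minus_commute)
    finally show ?thesis .
  qed
  ultimately show ?thesis
    using G_mono[OF p_in[OF x] y x] p_vi[OF x y] by simp
qed

text \<open>Testing each variational inequality with the other minimizer and adding them leaves only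
  a change of base point against strong monotonicity.\<close>

lemma p_lipschitz:
  assumes x: "x \<in> S" and y: "y \<in> S"
  shows "norm (p x - p y) \<le> K / c * norm (x - y)"
proof (cases "p x = p y")
  case True
  then show ?thesis using K_nonneg c_pos by simp
next
  case False
  have "c * (norm (p x - p y))\<^sup>2 \<le> (G (p x) x - G (p y) x) \<bullet> (p x - p y)"
    by (rule G_mono[OF p_in[OF x] p_in[OF y] x])
  also have "\<dots> \<le> (G (p y) y - G (p y) x) \<bullet> (p x - p y)"
    using p_vi[OF x p_in[OF y]] p_vi[OF y p_in[OF x]] by (simp add: algebra_simps)
  also have "\<dots> \<le> norm (G (p y) y - G (p y) x) * norm (p x - p y)"
    by (rule norm_cauchy_schwarz)
  also have "\<dots> \<le> K * norm (x - y) * norm (p x - p y)"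
    using G_lip[OF p_in[OF y] y x] by (intro mult_right_mono) (auto simp: norm_minus_commute)
  finally have "c * norm (p x - p y) * norm (p x - p y) \<le> K * norm (x - y) * norm (p x - p y)"
    by (simp add: power2_eq_square)
  then show ?thesis using False c_pos by (simp add: field_simps)
qed

lemma residual_diff:
  assumes x: "x \<in> S" and y: "y \<in> S"
  shows "\<bar>norm (p x - x) - norm (p y - y)\<bar> \<le> (K / c + 1) * norm (x - y)"
proof -
  have "\<bar>norm (p x - x) - norm (p y - y)\<bar> \<le> norm ((p x - x) - (p y - y))"
    by (rule norm_triangle_ineq3)
  also have "\<dots> = norm ((p x - p y) - (x - y))" by (simp add: algebra_simps)
  also have "\<dots> \<le> norm (p x - p y) + norm (x - y)" by (rule norm_triangle_ineq4)
  finally show ?thesis using p_lipschitz[OF x y] by (simp add: algebra_simps)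
qed

lemma inexact_iteration:
  fixes \<theta> :: "'a \<Rightarrow> real" and x z :: "nat \<Rightarrow> 'a" and \<gamma> \<epsilon> :: "nat \<Rightarrow> real"
  assumes L: "L \<ge> 0"
    and descent: "\<And>y w. y \<in> S \<Longrightarrow> w \<in> S \<Longrightarrow> \<theta> w \<le> \<theta> y + G y y \<bullet> (w - y) + L * (norm (w - y))\<^sup>2"
    and \<theta>_cont: "continuous_on S \<theta>"
    and coercive: "\<And>M. \<exists>R. \<forall>y\<in>S. norm y \<ge> R \<longrightarrow> \<theta> y \<ge> M"
    and x0: "x 0 \<in> S" and z_in: "\<And>n. z n \<in> S"
    and z_acc: "\<And>n. norm (z n - p (x n)) \<le> \<epsilon> n"
    and x_step: "\<And>n. x (Suc n) = x n + \<gamma> n *\<^sub>R (z n - x n)"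
    and \<epsilon>_lim: "\<epsilon> \<longlonglongrightarrow> 0"
    and \<gamma>_range: "\<And>n. 0 < \<gamma> n \<and> \<gamma> n \<le> 1" and \<gamma>_lim: "\<gamma> \<longlonglongrightarrow> 0"
    and \<gamma>_div: "\<not> summable \<gamma>" and \<epsilon>\<gamma>: "summable (\<lambda>n. \<epsilon> n * \<gamma> n)"
  shows "\<And>n. x n \<in> S" and "bounded (range x)" and "(\<lambda>n. norm (p (x n) - x n)) \<longlonglongrightarrow> 0"
proof -
  have \<gamma>: "0 < \<gamma> n" "0 \<le> \<gamma> n" "\<gamma> n \<le> 1" for n using \<gamma>_range[of n] by auto
  have \<epsilon>: "0 \<le> \<epsilon> n" for n using z_acc[of n] norm_ge_zero order_trans by blast
  have avg_in: "v + \<gamma> n *\<^sub>R (w - v) \<in> S" if "v \<in> S" "w \<in> S" for v w n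
    using convexD_alt[OF S_convex that \<gamma>(2,3)[of n]] by (simp add: algebra_simps)
  show x_in: "x n \<in> S" for n
    by (induction n) (simp_all add: x0 x_step avg_in z_in)
  \<comment> \<open>The target is \<open>p (x n)\<close>, not \<open>p (y n)\<close>: then
    \<open>x\<close> and \<open>y\<close> move towards points at most \<open>\<epsilon> n\<close>
    apart, and their distance contracts up to that error.\<close>
  define y where "y = rec_nat (x 0) (\<lambda>n v. v + \<gamma> n *\<^sub>R (p (x n) - v))"
  have y0: "y 0 = x 0" and y_step: "y (Suc n) = y n + \<gamma> n *\<^sub>R (p (x n) - y n)" for n
    by (simp_all add: y_def)
  have y_in: "y n \<in> S" for n
    by (induction n) (simp_all add: y0 x0 y_step avg_in p_in x_in)
  define d where "d n = norm (x n - y n)" for n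
  define r where "r n = norm (p (x n) - y n)" for n
  have d_step: "d (Suc n) \<le> (1 - \<gamma> n) * d n + \<epsilon> n * \<gamma> n" for n
  proof -
    have "x (Suc n) - y (Suc n) = (1 - \<gamma> n) *\<^sub>R (x n - y n) + \<gamma> n *\<^sub>R (z n - p (x n))"
      by (simp add: x_step y_step algebra_simps)
    then have "d (Suc n) \<le> norm ((1 - \<gamma> n) *\<^sub>R (x n - y n)) + norm (\<gamma> n *\<^sub>R (z n - p (x n)))"
      unfolding d_def by (metis norm_triangle_ineq)
    also have "\<dots> \<le> (1 - \<gamma> n) * d n + \<epsilon> n * \<gamma> n"
      using \<gamma>[of n] mult_left_mono[OF z_acc[of n] \<gamma>(2)[of n]] by (simp add: d_def mult.commute)
    finally show ?thesis .
  qed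
  define E where "E = (\<Sum>n. \<epsilon> n * \<gamma> n)"
  have d: "0 \<le> d n" for n by (simp add: d_def)
  have r: "0 \<le> r n" for n by (simp add: r_def)
  have "0 \<le> \<epsilon> n * \<gamma> n" for n using \<epsilon> \<gamma>(2) by simp
  note sce = summable_contraction_error[of d \<gamma> "\<lambda>n. \<epsilon> n * \<gamma> n", OF d \<gamma>(2) this \<epsilon>\<gamma> d_step]
  \<comment> \<open>Both sequences start at the same point, so \<open>d 0 = 0\<close>.\<close>
  have d_bound: "d n \<le> E" for n using sce(1)[of n] by (simp add: E_def d_def y0)
  note d_sum = sce(2)
  have d2_sum: "summable (\<lambda>n. \<gamma> n * (d n)\<^sup>2)"
  proof (rule summable_comparison_test_ev)
    have "norm (\<gamma> n * (d n)\<^sup>2) \<le> E * (\<gamma> n * d n)" for n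
      using mult_right_mono[OF d_bound[of n], of "\<gamma> n * d n"] d[of n] \<gamma>(2)[of n]
      by (simp add: power2_eq_square mult_ac)
    then show "\<forall>\<^sub>F n in sequentially. norm (\<gamma> n * (d n)\<^sup>2) \<le> E * (\<gamma> n * d n)" by simp
  qed (intro summable_mult d_sum)
  \<comment> \<open>Coercivity at level 0 bounds \<theta> below outside a ball; compactness does so
    inside.\<close>
  obtain m where m: "m \<le> \<theta> w" if "w \<in> S" for w
  proof -
    obtain R where R: "\<And>w. w \<in> S \<Longrightarrow> norm w \<ge> R \<Longrightarrow> \<theta> w \<ge> 0" using coercive[of 0] by blast
    have "compact (\<theta> ` (S \<inter> cball 0 R))"
      by (intro compact_continuous_image continuous_on_subset[OF \<theta>_cont] closed_Int_compact S_closed) auto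
    then obtain b where b: "\<And>w. w \<in> S \<inter> cball 0 R \<Longrightarrow> \<bar>\<theta> w\<bar> \<le> b"
      by (meson compact_imp_bounded bounded_real image_eqI)
    have "min 0 (- b) \<le> \<theta> w" if "w \<in> S" for w
      using R[OF that] b[of w] that by (cases "norm w \<ge> R") auto
    then show ?thesis by (rule that)
  qed
  \<comment> \<open>The threshold makes \<open>L * \<gamma> n \<le> c / 4\<close>;
    \<open>L + 1\<close> avoids dividing by zero.\<close>
  have "\<forall>\<^sub>F n in sequentially. \<gamma> n < c / (4 * (L + 1))"
    using order_tendstoD(2)[OF \<gamma>_lim] c_pos L by simp
  then obtain N where N: "\<And>n. n \<ge> N \<Longrightarrow> \<gamma> n < c / (4 * (L + 1))"
    by (auto simp: eventually_sequentially)
  \<comment> \<open>Of the decrease \<open>c * (r n)\<^sup>2\<close>, one quarter absorbs the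
    curvature term and one quarter the cross term \<open>K * d n * r n\<close>; half
    remains.\<close>
  have \<theta>_step: "\<theta> (y (Suc n)) + c / 2 * (\<gamma> n * (r n)\<^sup>2) \<le> \<theta> (y n) + K\<^sup>2 / c * (\<gamma> n * (d n)\<^sup>2)"
    if n: "n \<ge> N" for n
  proof -
    have "\<theta> (y (Suc n)) \<le> \<theta> (y n) + G (y n) (y n) \<bullet> (y (Suc n) - y n) + L * (norm (y (Suc n) - y n))\<^sup>2"
      by (rule descent[OF y_in y_in])
    also have "\<dots> = \<theta> (y n) + \<gamma> n * (G (y n) (y n) \<bullet> (p (x n) - y n) + (L * \<gamma> n) * (r n)\<^sup>2)"
      by (simp add: y_step r_def power_mult_distrib distrib_left power2_eq_square mult_ac)
    also have "\<dots> \<le> \<theta> (y n) + \<gamma> n * (- (c / 2) * (r n)\<^sup>2 + K\<^sup>2 / c * (d n)\<^sup>2)"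
    proof -
      have "L * \<gamma> n \<le> (L + 1) * \<gamma> n" using \<gamma>(2)[of n] by (simp add: algebra_simps)
      also have "\<dots> \<le> c / 4" using N[OF n] L by (simp add: field_simps)
      finally have "(L * \<gamma> n) * (r n)\<^sup>2 \<le> c / 4 * (r n)\<^sup>2" by (intro mult_right_mono) auto
      moreover have "K * d n * r n \<le> c / 4 * (r n)\<^sup>2 + K\<^sup>2 / c * (d n)\<^sup>2"
      proof -
        \<comment> \<open>Young's inequality as a square, weighted so that
          \<open>(r n)\<^sup>2\<close> receives exactly \<open>c / 4\<close>.\<close>
        have "0 \<le> (c / 2 * r n - K * d n)\<^sup>2 / c" using c_pos by simp
        also have "\<dots> = c / 4 * (r n)\<^sup>2 + K\<^sup>2 / c * (d n)\<^sup>2 - K * d n * r n"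
          using c_pos by (simp add: power2_eq_square field_simps)
        finally show ?thesis by simp
      qed
      moreover have "G (y n) (y n) \<bullet> (p (x n) - y n) \<le> - c * (r n)\<^sup>2 + K * d n * r n"
        using descent_direction[OF x_in[of n] y_in[of n]] by (simp add: r_def d_def)
      ultimately have "G (y n) (y n) \<bullet> (p (x n) - y n) + (L * \<gamma> n) * (r n)\<^sup>2
          \<le> - (c / 2) * (r n)\<^sup>2 + K\<^sup>2 / c * (d n)\<^sup>2" by simp
      then show ?thesis using \<gamma>(2)[of n] by (simp add: mult_left_mono)
    qed
    finally show ?thesis by (simp add: algebra_simps)
  qed
  define e where "e n = K\<^sup>2 / c * (\<gamma> n * (d n)\<^sup>2)" for n
  have e: "0 \<le> e n" for n using c_pos \<gamma>(2)[of n] by (simp add: e_def)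
  have e_sum: "summable e" unfolding e_def by (intro summable_mult d2_sum)
  have b: "0 \<le> c / 2 * (\<gamma> n * (r n)\<^sup>2)" for n using c_pos \<gamma>(2)[of n] by simp
  note qd = quasi_descent[of N "\<lambda>n. \<theta> (y n)" "\<lambda>n. c / 2 * (\<gamma> n * (r n)\<^sup>2)" e m,
      OF \<theta>_step[folded e_def] b e e_sum m[OF y_in]]
  have r_sum: "summable (\<lambda>n. \<gamma> n * (r n)\<^sup>2)"
    using summable_mult[OF qd(2), of "2 / c"] c_pos by simp
  \<comment> \<open>The extra 1 makes the level strictly exceed every \<open>\<theta> (y n)\<close>
    with \<open>n \<ge> N\<close>, so these points have norm below \<open>R\<close>.\<close>
  obtain R where R: "\<And>w. w \<in> S \<Longrightarrow> norm w \<ge> R \<Longrightarrow> \<theta> w \<ge> \<theta> (y N) + suminf e + 1"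
    using coercive by blast
  have tail: "norm (x n) \<le> R + E" if "n \<ge> N" for n
  proof -
    have "norm (y n) < R" using R[OF y_in[of n]] qd(1)[of n] that by fastforce
    moreover have "norm (x n) \<le> norm (y n) + d n"
      unfolding d_def by (metis norm_triangle_sub)
    ultimately show ?thesis using d_bound[of n] by simp
  qed
  have "x n \<in> x ` {..<N} \<union> cball 0 (R + E)" for n
    using tail[of n] by (cases "n < N") auto
  then have "range x \<subseteq> x ` {..<N} \<union> cball 0 (R + E)" by blast
  then show "bounded (range x)"
    by (rule bounded_subset[rotated]) (simp add: finite_imp_bounded)
  define q where "q n = norm (p (x n) - x n)" for n
  have q: "0 \<le> q n" for n by (simp add: q_def)
  have q_sum: "summable (\<lambda>n. \<gamma> n * (q n)\<^sup>2)"
  proof (rule summable_comparison_test_ev)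
    have "norm (\<gamma> n * (q n)\<^sup>2) \<le> 2 * (\<gamma> n * (r n)\<^sup>2) + 2 * (\<gamma> n * (d n)\<^sup>2)" for n
    proof -
      have "q n \<le> r n + d n"
        unfolding q_def r_def d_def using norm_triangle_ineq4[of "p (x n) - y n" "x n - y n"] by simp
      then have "(q n)\<^sup>2 \<le> (r n + d n)\<^sup>2" using q by (intro power_mono)
      also have "\<dots> \<le> 2 * (r n)\<^sup>2 + 2 * (d n)\<^sup>2"
        using sum_squares_ge_zero[of "r n - d n" 0] by (simp add: power2_eq_square algebra_simps)
      finally have "\<gamma> n * (q n)\<^sup>2 \<le> \<gamma> n * (2 * (r n)\<^sup>2 + 2 * (d n)\<^sup>2)"
        using \<gamma>(2) by (rule mult_left_mono)
      then show ?thesis using \<gamma>(2)[of n] by (simp add: algebra_simps)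
    qed
    then show "\<forall>\<^sub>F n in sequentially. norm (\<gamma> n * (q n)\<^sup>2) \<le> 2 * (\<gamma> n * (r n)\<^sup>2) + 2 * (\<gamma> n * (d n)\<^sup>2)"
      by simp
  qed (intro summable_add summable_mult r_sum d2_sum)
  \<comment> \<open>Eventually \<open>\<epsilon> n < 1\<close>, so the square is dominated by
    \<open>\<epsilon> n\<close> itself.\<close>
  have \<epsilon>2_sum: "summable (\<lambda>n. \<gamma> n * (\<epsilon> n)\<^sup>2)"
  proof (rule summable_comparison_test_ev)
    have "\<forall>\<^sub>F n in sequentially. \<epsilon> n < 1" using order_tendstoD(2)[OF \<epsilon>_lim] by simp
    then show "\<forall>\<^sub>F n in sequentially. norm (\<gamma> n * (\<epsilon> n)\<^sup>2) \<le> \<epsilon> n * \<gamma> n"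
    proof eventually_elim
      case (elim n)
      then have "\<epsilon> n * (\<epsilon> n * \<gamma> n) \<le> 1 * (\<epsilon> n * \<gamma> n)" using \<epsilon>[of n] \<gamma>(2)[of n] by (intro mult_right_mono) auto
      then show ?case using \<gamma>(2)[of n] by (simp add: power2_eq_square abs_mult mult_ac \<epsilon>)
    qed
  qed (rule \<epsilon>\<gamma>)
  define A where "A = K / c + 1"
  have A: "A \<ge> 0" using K_nonneg c_pos by (simp add: A_def)
  define B where "B = 2 * A * (2 + A)"
  \<comment> \<open>Squares are used because summability is available for
    \<open>\<gamma> n * (q n)\<^sup>2\<close>. In the factored difference, one factor is of order
    \<open>\<gamma> n * t\<close> by the step length, the other of order \<open>t\<close>.\<close>
  have q_var: "\<bar>(q (Suc n))\<^sup>2 - (q n)\<^sup>2\<bar> \<le> B * (\<gamma> n * (q n)\<^sup>2) + B * (\<gamma> n * (\<epsilon> n)\<^sup>2)" for n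
  proof -
    define t where "t = q n + \<epsilon> n"
    have t: "0 \<le> t" "q n \<le> t" using q \<epsilon> by (auto simp: t_def)
    have "norm (x (Suc n) - x n) = \<gamma> n * norm ((p (x n) - x n) + (z n - p (x n)))"
      using \<gamma>(2)[of n] by (simp add: x_step)
    also have "\<dots> \<le> \<gamma> n * t"
      using norm_triangle_ineq[of "p (x n) - x n" "z n - p (x n)"] z_acc[of n] \<gamma>(2)[of n]
      by (intro mult_left_mono) (auto simp: t_def q_def)
    finally have diff: "\<bar>q (Suc n) - q n\<bar> \<le> A * (\<gamma> n * t)"
      using residual_diff[OF x_in[of "Suc n"] x_in[of n]] A
      unfolding q_def A_def[symmetric] by (meson mult_left_mono order_trans)
    \<comment> \<open>Since \<open>\<gamma> n \<le> 1\<close>, one step raises \<open>q n\<close> by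
      at most \<open>A * t\<close>, which gives the factor \<open>2 + A\<close>.\<close>
    have "A * (\<gamma> n * t) \<le> A * (1 * t)" using A t \<gamma> by (intro mult_left_mono mult_right_mono) auto
    then have "q (Suc n) + q n \<le> (2 + A) * t" using diff t by (simp add: algebra_simps)
    with diff have "\<bar>q (Suc n) - q n\<bar> * (q (Suc n) + q n) \<le> A * (\<gamma> n * t) * ((2 + A) * t)"
      using A t q \<gamma>(2)[of n] by (intro mult_mono) auto
    also have "\<dots> = A * (2 + A) * \<gamma> n * t\<^sup>2" by (simp add: power2_eq_square)
    also have "\<dots> \<le> A * (2 + A) * \<gamma> n * (2 * (q n)\<^sup>2 + 2 * (\<epsilon> n)\<^sup>2)"
    proof (rule mult_left_mono)
      show "t\<^sup>2 \<le> 2 * (q n)\<^sup>2 + 2 * (\<epsilon> n)\<^sup>2"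
        using sum_squares_ge_zero[of "q n - \<epsilon> n" 0] by (simp add: t_def power2_eq_square algebra_simps)
    qed (use A \<gamma>(2)[of n] in auto)
    finally have "\<bar>q (Suc n) - q n\<bar> * (q (Suc n) + q n) \<le> B * (\<gamma> n * (q n)\<^sup>2) + B * (\<gamma> n * (\<epsilon> n)\<^sup>2)"
      by (simp add: B_def algebra_simps)
    moreover have "\<bar>(q (Suc n))\<^sup>2 - (q n)\<^sup>2\<bar> = \<bar>q (Suc n) - q n\<bar> * (q (Suc n) + q n)"
    proof -
      have "(q (Suc n))\<^sup>2 - (q n)\<^sup>2 = (q (Suc n) - q n) * (q (Suc n) + q n)"
        by (simp add: power2_eq_square algebra_simps)
      then show ?thesis using q by (simp add: abs_mult)
    qed
    ultimately show ?thesis by simp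
  qed
  have "(\<lambda>n. (q n)\<^sup>2) \<longlonglongrightarrow> 0"
  proof (rule tendsto_zero_of_weighted_summable[OF _ \<gamma>(2) \<gamma>_div q_sum])
    show "summable (\<lambda>n. \<bar>(q (Suc n))\<^sup>2 - (q n)\<^sup>2\<bar>)"
      by (rule summable_comparison_test_ev[where g="\<lambda>n. B * (\<gamma> n * (q n)\<^sup>2) + B * (\<gamma> n * (\<epsilon> n)\<^sup>2)"])
        (use q_var in \<open>auto intro!: summable_add summable_mult q_sum \<epsilon>2_sum\<close>)
  qed simp
  then have "(\<lambda>n. sqrt ((q n)\<^sup>2)) \<longlonglongrightarrow> sqrt 0" by (rule tendsto_real_sqrt)
  then show "(\<lambda>n. norm (p (x n) - x n)) \<longlonglongrightarrow> 0" using q by (simp add: q_def)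
qed

text \<open>The residual is Lipschitz by \<open>residual_diff\<close>, so its value at the limit is
  the limit of the residuals along the subsequence.\<close>

lemma limit_point_fixed:
  assumes x: "\<And>n. x n \<in> S" and res: "(\<lambda>n. norm (p (x n) - x n)) \<longlonglongrightarrow> 0"
    and l: "seq_limit_point x l"
  shows "l \<in> S" and "p l = l"
proof -
  obtain r where r: "strict_mono r" and lim: "(x \<circ> r) \<longlonglongrightarrow> l"
    using l by (auto simp: seq_limit_point_def)
  show "l \<in> S" by (rule closed_sequentially[OF S_closed _ lim]) (simp add: x)
  have "(\<lambda>n. norm (p ((x \<circ> r) n) - (x \<circ> r) n) + (K / c + 1) * norm ((x \<circ> r) n - l)) \<longlonglongrightarrow> 0 + (K / c + 1) * norm (l - l)"
    using LIMSEQ_subseq_LIMSEQ[OF res r] by (intro tendsto_intros lim) (simp add: comp_def)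
  moreover have "norm (p l - l) \<le> norm (p ((x \<circ> r) n) - (x \<circ> r) n) + (K / c + 1) * norm ((x \<circ> r) n - l)" for n
    using residual_diff[OF \<open>l \<in> S\<close> x[of "r n"]] by (simp add: norm_minus_commute)
  ultimately have "norm (p l - l) \<le> 0"
    by (intro LIMSEQ_le_const[where a="norm (p l - l)"]) auto
  then show "p l = l" by simp
qed

end

section \<open>Algebra of block projections and blends\<close>

lemma blockproj_nth [simp]: "blockproj blk i x $ k = (if blk k = i then x $ k else 0)"
  by (simp add: blockproj_def)

lemma linear_blockproj: "linear (blockproj blk i)"
  by (rule linearI) (simp_all add: vec_eq_iff)

lemmas blockproj_add = linear_add[OF linear_blockproj]
  and blockproj_diff = linear_diff[OF linear_blockproj]
  and blockproj_scaleR = linear_scale[OF linear_blockproj]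

lemma blockproj_blockproj: "blockproj blk i (blockproj blk j x) = (if i = j then blockproj blk i x else 0)"
  by (simp add: vec_eq_iff)

lemma inner_blockproj_left: "blockproj blk i v \<bullet> w = v \<bullet> blockproj blk i w"
  by (simp add: inner_vec_def if_distrib if_distribR cong: if_cong)

lemma inner_blockproj_both: "blockproj blk i v \<bullet> blockproj blk i w = v \<bullet> blockproj blk i w"
  by (simp add: inner_blockproj_left blockproj_blockproj)

lemma sum_blockproj: "(\<Sum>i\<in>UNIV. blockproj blk i x) = x" for blk :: "'n::finite \<Rightarrow> 'b::finite"
  by (simp add: vec_eq_iff)

lemma sum_norm_blockproj: "(\<Sum>i\<in>UNIV. (norm (blockproj blk i x))\<^sup>2) = (norm x)\<^sup>2"
  for blk :: "'n::finite \<Rightarrow> 'b::finite"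
proof -
  have "(\<Sum>i\<in>UNIV. (norm (blockproj blk i x))\<^sup>2) = (\<Sum>i\<in>UNIV. x \<bullet> blockproj blk i x)"
    by (simp add: power2_norm_eq_inner inner_blockproj_both)
  also have "\<dots> = x \<bullet> (\<Sum>i\<in>UNIV. blockproj blk i x)" by (simp add: inner_sum_right)
  finally show ?thesis by (simp add: sum_blockproj power2_norm_eq_inner)
qed

lemma norm_blockproj_le: "norm (blockproj blk i x) \<le> norm x"
  by (rule norm_le_componentwise_cart) auto

lemma blockproj_blend: "blockproj blk j (blend blk i x y) = blockproj blk j (if j = i then x else y)"
  by (simp add: blend_def vec_eq_iff)

lemma blend_self: "blend blk i x x = x"
  by (simp add: blend_def)

text \<open>\<open>c_f\<close> blends embedded block vectors from \<open>Xs i\<close>; this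
  transfers its inequality to full vectors.\<close>

lemma blend_blockproj: "blend blk i (blockproj blk i x) y = blend blk i x y"
  by (simp add: blend_def blockproj_blockproj)

lemma blend_mem_Xprod: "x \<in> Xprod blk Xs \<Longrightarrow> y \<in> Xprod blk Xs \<Longrightarrow> blend blk i x y \<in> Xprod blk Xs"
  by (simp add: Xprod_def blockproj_blend)

lemma norm_blend_diff_le: "norm (blend blk i x y - blend blk i x w) \<le> norm (y - w)"
  by (rule norm_le_componentwise_cart) (auto simp: blend_def)

section \<open>Closedness and convexity of the feasible set\<close>

lemma Xprod_eq: "Xprod blk Xs = (\<Inter>i. blockproj blk i -` Xs i)"
  by (auto simp: Xprod_def)

lemma closed_Xprod: "closed (Xprod blk Xs)" if "\<And>i. closed (Xs i)"
  for blk :: "'n::finite \<Rightarrow> 'b::finite"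
  unfolding Xprod_eq
  by (intro closed_INT ballI closed_vimage that linear_continuous_on linear_conv_bounded_linear[THEN iffD1] linear_blockproj)

lemma convex_Xprod: "convex (Xprod blk Xs)" if "\<And>i. convex (Xs i)"
  unfolding Xprod_eq by (intro convex_INT convex_linear_vimage linear_blockproj that)

lemma closed_Xi_set:
  fixes blk :: "'n::finite \<Rightarrow> 'b::finite"
  assumes "\<And>i. closed (Xs i)" and "\<And>j. j < nc \<Longrightarrow> continuous_on (Xprod blk Xs) (h j)"
  shows "closed (Xi_set blk Xs nc h)"
proof -
  \<comment> \<open>Each sublevel set is taken inside the product, where \<open>h j\<close> is
    assumed continuous.\<close>
  have "Xi_set blk Xs nc h = Xprod blk Xs \<inter> (\<Inter>j\<in>{..<nc}. {x \<in> Xprod blk Xs. h j x \<le> 0})"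
    by (auto simp: Xi_set_def)
  moreover have "closed {x \<in> Xprod blk Xs. h j x \<le> 0}" if "j < nc" for j
    by (rule continuous_on_closed_Collect_le) (use assms that in \<open>auto intro: closed_Xprod\<close>)
  ultimately show ?thesis by (auto intro!: closed_Int closed_Xprod assms(1))
qed

lemma convex_Xi_set:
  assumes Xs: "\<And>i. convex (Xs i)" and h: "\<And>j. j < nc \<Longrightarrow> convex_on (Xprod blk Xs) (h j)"
  shows "convex (Xi_set blk Xs nc h)"
proof (rule convexI)
  fix x y and u v :: real
  assume x: "x \<in> Xi_set blk Xs nc h" and y: "y \<in> Xi_set blk Xs nc h"
    and uv: "0 \<le> u" "0 \<le> v" "u + v = 1"
  have "h j (u *\<^sub>R x + v *\<^sub>R y) \<le> 0" if j: "j < nc" for j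
  proof -
    have "h j (u *\<^sub>R x + v *\<^sub>R y) \<le> u * h j x + v * h j y"
      using h[OF j] x y uv unfolding convex_on_def Xi_set_def by blast
    also have "\<dots> \<le> 0"
      using x y uv j by (intro add_nonpos_nonpos mult_nonneg_nonpos) (auto simp: Xi_set_def)
    finally show ?thesis .
  qed
  then show "u *\<^sub>R x + v *\<^sub>R y \<in> Xi_set blk Xs nc h"
    using convexD[OF convex_Xprod[OF Xs] _ _ uv, where x=x and y=y] x y by (auto simp: Xi_set_def)
qed

section \<open>The gradient of the surrogate\<close>

text \<open>The gradient of the surrogate in \<open>x\<close>, arranged as the gradient of \<theta>
  at \<open>y\<close> plus a blockwise correction that vanishes for \<open>x = y\<close>.\<close>

definition theta_tilde_grad ::
    "('n \<Rightarrow> 'b::finite) \<Rightarrow> ('b \<Rightarrow> real^'n \<Rightarrow> real^'n) \<Rightarrow> ('b \<Rightarrow> real^'n \<Rightarrow> real^'n)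
      \<Rightarrow> ('b \<Rightarrow> real) \<Rightarrow> real^'n \<Rightarrow> real^'n \<Rightarrow> real^'n" where
  "theta_tilde_grad blk Df Dg tau x y =
     (\<Sum>i\<in>UNIV. Df i y - Dg i y)
   + (\<Sum>i\<in>UNIV. blockproj blk i (Df i (blend blk i x y) - Df i y + tau i *\<^sub>R (x - y)))"

lemma theta_tilde_grad_self: "theta_tilde_grad blk Df Dg tau y y = (\<Sum>i\<in>UNIV. Df i y - Dg i y)"
  by (simp add: theta_tilde_grad_def blend_self linear_0[OF linear_blockproj])

lemma theta_tilde_has_derivative:
  fixes blk :: "'n::finite \<Rightarrow> 'b::finite"
  assumes "\<And>i. (f i has_derivative (\<lambda>v. Df i (blend blk i x y) \<bullet> v)) (at (blend blk i x y))"
  shows "((\<lambda>x. theta_tilde blk f g Df Dg tau x y) has_derivative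
           (\<lambda>v. theta_tilde_grad blk Df Dg tau x y \<bullet> v)) (at x)"
proof -
  have P: "(blockproj blk i has_derivative blockproj blk i) (at x)" for i
    by (rule linear_imp_has_derivative[OF linear_blockproj])
  have "((\<lambda>x. blend blk i x y) has_derivative blockproj blk i) (at x)" for i
    unfolding blend_def by (auto intro!: derivative_eq_intros P)
  then have f: "((\<lambda>x. f i (blend blk i x y)) has_derivative
      (\<lambda>v. Df i (blend blk i x y) \<bullet> blockproj blk i v)) (at x)" for i
    by (rule has_derivative_compose) (rule assms)
  have lin: "((\<lambda>x. a \<bullet> (blockproj blk i x - blockproj blk i y)) has_derivative (\<lambda>v. a \<bullet> blockproj blk i v)) (at x)" for a i
    by (auto intro!: derivative_eq_intros P)
  have sq: "((\<lambda>x. (norm (blockproj blk i x - blockproj blk i y))\<^sup>2) has_derivative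
      (\<lambda>v. 2 * ((x - y) \<bullet> blockproj blk i v))) (at x)" for i
    unfolding power2_norm_eq_inner
    by (rule derivative_eq_intros P refl)+
      (simp add: fun_eq_iff inner_commute inner_blockproj_both flip: blockproj_diff,
       metis inner_blockproj_both inner_commute)
  have "((\<lambda>x. theta_tilde blk f g Df Dg tau x y) has_derivative
      (\<lambda>v. \<Sum>i\<in>UNIV. Df i (blend blk i x y) \<bullet> blockproj blk i v
        + (\<Sum>j\<in>UNIV - {i}. blockproj blk i (Df j y) \<bullet> blockproj blk i v) - 0
        - (\<Sum>j\<in>UNIV. blockproj blk i (Dg j y) \<bullet> blockproj blk i v)
        + tau i / 2 * (2 * ((x - y) \<bullet> blockproj blk i v)))) (at x)"
    unfolding theta_tilde_def
    by (intro has_derivative_sum has_derivative_add has_derivative_diff has_derivative_const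
        has_derivative_mult_right f lin sq)
  moreover have "(\<Sum>i\<in>UNIV. Df i (blend blk i x y) \<bullet> blockproj blk i v
        + (\<Sum>j\<in>UNIV - {i}. blockproj blk i (Df j y) \<bullet> blockproj blk i v) - 0
        - (\<Sum>j\<in>UNIV. blockproj blk i (Dg j y) \<bullet> blockproj blk i v)
        + tau i / 2 * (2 * ((x - y) \<bullet> blockproj blk i v)))
      = theta_tilde_grad blk Df Dg tau x y \<bullet> v" for v
  proof -
    define D where "D = (\<Sum>i\<in>UNIV. Df i y - Dg i y)"
    have "Df i (blend blk i x y) \<bullet> blockproj blk i v
        + (\<Sum>j\<in>UNIV - {i}. blockproj blk i (Df j y) \<bullet> blockproj blk i v) - 0
        - (\<Sum>j\<in>UNIV. blockproj blk i (Dg j y) \<bullet> blockproj blk i v)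
        + tau i / 2 * (2 * ((x - y) \<bullet> blockproj blk i v))
      = D \<bullet> blockproj blk i v
        + blockproj blk i (Df i (blend blk i x y) - Df i y + tau i *\<^sub>R (x - y)) \<bullet> v" for i
    proof -
      \<comment> \<open>Completing the sum over \<open>j \<noteq> i\<close> produces block
        \<open>i\<close> of \<open>D\<close>; the subtracted \<open>Df i y\<close> goes into the
        correction.\<close>
      have "(\<Sum>j\<in>UNIV - {i}. Df j y) = (\<Sum>j\<in>UNIV. Df j y) - Df i y"
        by (simp add: sum_diff1)
      then show ?thesis
        by (simp add: inner_blockproj_left blockproj_blockproj D_def sum_subtractf
            inner_diff_left inner_add_left right_diff_distrib flip: inner_sum_left)
    qed
    then show ?thesis
      by (simp add: sum.distrib theta_tilde_grad_def sum_blockproj inner_add_left inner_sum_left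
          flip: D_def inner_sum_right)
  qed
  ultimately show ?thesis by simp
qed

text \<open>A real \<open>c\<close> strictly between 0 and \<open>c_tau\<close> avoids both infinite
  values and attainment of the supremum in \<open>c_f\<close>: some admissible constant exceeds
  \<open>c - tau i\<close>, which may be negative.\<close>

lemma c_tau_pos_imp_strong_monotonicity:
  fixes blk :: "'n::finite \<Rightarrow> 'b::finite"
  assumes "0 < c_tau blk Xs Df tau"
  obtains c where "c > 0"
    and "\<And>i u w y. u \<in> Xprod blk Xs \<Longrightarrow> w \<in> Xprod blk Xs \<Longrightarrow> y \<in> Xprod blk Xs \<Longrightarrow>
      (c - tau i) * (norm (blockproj blk i (u - w)))\<^sup>2
        \<le> (Df i (blend blk i u y) - Df i (blend blk i w y)) \<bullet> blockproj blk i (u - w)"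
proof -
  obtain c where c: "0 < ereal c" "ereal c < c_tau blk Xs Df tau"
    using ereal_dense2[OF assms] by blast
  have "(c - tau i) * (norm (blockproj blk i (u - w)))\<^sup>2
      \<le> (Df i (blend blk i u y) - Df i (blend blk i w y)) \<bullet> blockproj blk i (u - w)"
    if u: "u \<in> Xprod blk Xs" and w: "w \<in> Xprod blk Xs" and y: "y \<in> Xprod blk Xs" for i u w y
  proof -
    have "ereal c < ereal (tau i) + (INF z\<in>Xprod blk Xs. c_f blk Xs Df i z)"
      using c(2) by (simp add: c_tau_def)
    also have "\<dots> \<le> ereal (tau i) + c_f blk Xs Df i y"
      by (intro add_left_mono INF_lower y)
    finally have "ereal (c - tau i) < c_f blk Xs Df i y"
      by (cases "c_f blk Xs Df i y") auto
    then obtain c' where c': "c - tau i < c'"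
      and mono: "\<And>a b. a \<in> Xs i \<Longrightarrow> b \<in> Xs i \<Longrightarrow> c' * (norm (a - b))\<^sup>2 \<le>
        (a - b) \<bullet> (blockproj blk i (Df i (blend blk i a y)) - blockproj blk i (Df i (blend blk i b y)))"
      unfolding c_f_def less_Sup_iff by auto
    have "(c - tau i) * (norm (blockproj blk i (u - w)))\<^sup>2 \<le> c' * (norm (blockproj blk i (u - w)))\<^sup>2"
      using c' by (intro mult_right_mono) auto
    also have "\<dots> \<le> blockproj blk i (u - w) \<bullet>
        blockproj blk i (Df i (blend blk i u y) - Df i (blend blk i w y))"
      using mono[of "blockproj blk i u" "blockproj blk i w"] u w
      by (simp add: Xprod_def blend_blockproj blockproj_diff)
    also have "\<dots> = (Df i (blend blk i u y) - Df i (blend blk i w y)) \<bullet> blockproj blk i (u - w)"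
      by (metis inner_blockproj_both inner_commute)
    finally show ?thesis .
  qed
  with c(1) show ?thesis by (intro that) auto
qed

text \<open>For fixed \<open>y\<close> the base gradient cancels and the blocks decouple, so the
  blockwise inequalities add up; the proximal term supplies the missing
  \<open>tau i\<close>.\<close>

lemma theta_tilde_grad_strongly_monotone:
  fixes blk :: "'n::finite \<Rightarrow> 'b::finite"
  assumes "\<And>i. (c - tau i) * (norm (blockproj blk i (u - w)))\<^sup>2
        \<le> (Df i (blend blk i u y) - Df i (blend blk i w y)) \<bullet> blockproj blk i (u - w)"
  shows "c * (norm (u - w))\<^sup>2
    \<le> (theta_tilde_grad blk Df Dg tau u y - theta_tilde_grad blk Df Dg tau w y) \<bullet> (u - w)"
proof -
  have "c * (norm (u - w))\<^sup>2 = (\<Sum>i\<in>UNIV. c * (norm (blockproj blk i (u - w)))\<^sup>2)"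
    by (simp add: sum_norm_blockproj flip: sum_distrib_left)
  also have "\<dots> \<le> (\<Sum>i\<in>UNIV. (Df i (blend blk i u y) - Df i (blend blk i w y)) \<bullet> blockproj blk i (u - w)
      + tau i * (norm (blockproj blk i (u - w)))\<^sup>2)"
    using assms by (intro sum_mono) (simp add: algebra_simps)
  also have "\<dots> = (\<Sum>i\<in>UNIV. blockproj blk i (Df i (blend blk i u y) - Df i (blend blk i w y)
      + tau i *\<^sub>R (u - w)) \<bullet> (u - w))"
    by (simp only: inner_blockproj_left inner_add_left inner_scaleR_left power2_norm_eq_inner
        blockproj_blockproj refl if_True)
  also have "\<dots> = (theta_tilde_grad blk Df Dg tau u y - theta_tilde_grad blk Df Dg tau w y) \<bullet> (u - w)"
    unfolding theta_tilde_grad_def inner_sum_left[symmetric]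
    by (simp add: blockproj_add blockproj_diff blockproj_scaleR scaleR_diff_right flip: sum_subtractf)
      (simp add: algebra_simps)
  finally show ?thesis .
qed

text \<open>\<open>Df i\<close> varies three times: in the base gradient, at the blended point and
  in the subtracted \<open>Df i y\<close>. \<open>Dg i\<close> and the proximal term vary once
  each.\<close>

lemma theta_tilde_grad_lipschitz:
  fixes blk :: "'n::finite \<Rightarrow> 'b::finite"
  assumes tau: "\<And>i. 0 \<le> tau i"
    and A: "\<And>i. (A i)-lipschitz_on (Xprod blk Xs) (Df i)"
    and B: "\<And>i. (B i)-lipschitz_on (Xprod blk Xs) (Dg i)"
    and u: "u \<in> Xprod blk Xs" and y: "y \<in> Xprod blk Xs" and w: "w \<in> Xprod blk Xs"
  shows "norm (theta_tilde_grad blk Df Dg tau u y - theta_tilde_grad blk Df Dg tau u w)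
    \<le> (\<Sum>i\<in>UNIV. 3 * A i + B i + tau i) * norm (y - w)"
proof -
  define a where "a i = Df i (blend blk i u y) - Df i (blend blk i u w)
      - (Df i y - Df i w) - tau i *\<^sub>R (y - w)" for i
  have Df: "norm (Df i y - Df i w) \<le> A i * norm (y - w)" for i
    using lipschitz_onD[OF A y w] by (simp add: dist_norm)
  have Dg: "norm (Dg i y - Dg i w) \<le> B i * norm (y - w)" for i
    using lipschitz_onD[OF B y w] by (simp add: dist_norm)
  have "norm (Df i (blend blk i u y) - Df i (blend blk i u w)) \<le> A i * norm (y - w)" for i
    by (rule order_trans[OF lipschitz_on_normD[OF A blend_mem_Xprod[OF u y] blend_mem_Xprod[OF u w]]])
      (intro mult_left_mono norm_blend_diff_le lipschitz_on_nonneg[OF A])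
  then have a: "norm (a i) \<le> A i * norm (y - w) + A i * norm (y - w) + tau i * norm (y - w)" for i
    unfolding a_def using Df tau[of i]
    by (intro order_trans[OF norm_triangle_ineq4 add_mono]) auto
  have eq: "theta_tilde_grad blk Df Dg tau u y - theta_tilde_grad blk Df Dg tau u w
      = (\<Sum>i\<in>UNIV. (Df i y - Df i w) - (Dg i y - Dg i w) + blockproj blk i (a i))"
    unfolding theta_tilde_grad_def a_def blockproj_add blockproj_diff blockproj_scaleR
    by (simp add: sum.distrib sum_subtractf scaleR_diff_right)
  have "norm (theta_tilde_grad blk Df Dg tau u y - theta_tilde_grad blk Df Dg tau u w)
      \<le> (\<Sum>i\<in>UNIV. A i * norm (y - w) + B i * norm (y - w)
      + (A i * norm (y - w) + A i * norm (y - w) + tau i * norm (y - w)))"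
    unfolding eq
    by (intro sum_norm_le order_trans[OF norm_triangle_ineq] add_mono order_trans[OF norm_triangle_ineq4]
        order_trans[OF norm_blockproj_le] Df Dg a)
  also have "\<dots> = (\<Sum>i\<in>UNIV. 3 * A i + B i + tau i) * norm (y - w)"
    unfolding sum_distrib_right by (intro sum.cong refl) (simp add: algebra_simps)
  finally show ?thesis .
qed

section \<open>Instantiation of the surrogate map for the DC problem\<close>

theorem theorem3:
  fixes blk :: "'n::finite \<Rightarrow> 'b::finite"
    and Xs :: "'b \<Rightarrow> (real^'n) set"
    and f g :: "'b \<Rightarrow> real^'n \<Rightarrow> real"
    and Df Dg :: "'b \<Rightarrow> real^'n \<Rightarrow> real^'n"
    and nc :: nat and h :: "nat \<Rightarrow> real^'n \<Rightarrow> real" and Dh :: "nat \<Rightarrow> real^'n \<Rightarrow> real^'n"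
    and tau :: "'b \<Rightarrow> real"
    and x z :: "nat \<Rightarrow> real^'n" and gamma eps :: "nat \<Rightarrow> real"
    and U :: "(real^'n) set"
  defines "X \<equiv> Xprod blk Xs"
    and "Xi \<equiv> Xi_set blk Xs nc h"
    and "theta \<equiv> (\<lambda>y. \<Sum>i\<in>UNIV. f i y - g i y)"
    and "Dtheta \<equiv> (\<lambda>y. \<Sum>i\<in>UNIV. Df i y - Dg i y)"
  assumes blocks_nonempty: "surj blk"
    and Xs_sub: "\<And>i. Xs i \<subseteq> block_space blk i"
    and Xs_ne: "\<And>i. Xs i \<noteq> {}"
    and Xs_closed: "\<And>i. closed (Xs i)"
    and Xs_convex: "\<And>i. convex (Xs i)"
    and Xi_ne: "Xi \<noteq> {}"
    \<comment> \<open>(A1): convex and continuously differentiable on an open set \<open>U \<supseteq> \<X>\<close>\<close>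
    and U_open: "open U" and X_U: "X \<subseteq> U"
    and f_deriv: "\<And>i y. y \<in> U \<Longrightarrow> (f i has_derivative (\<lambda>v. Df i y \<bullet> v)) (at y)"
    and g_deriv: "\<And>i y. y \<in> U \<Longrightarrow> (g i has_derivative (\<lambda>v. Dg i y \<bullet> v)) (at y)"
    and h_deriv: "\<And>j y. j < nc \<Longrightarrow> y \<in> U \<Longrightarrow> (h j has_derivative (\<lambda>v. Dh j y \<bullet> v)) (at y)"
    and Df_cont: "\<And>i. continuous_on U (Df i)"
    and Dg_cont: "\<And>i. continuous_on U (Dg i)"
    and Dh_cont: "\<And>j. j < nc \<Longrightarrow> continuous_on U (Dh j)"
    and f_convex: "\<And>i. convex_on X (f i)"
    and g_convex: "\<And>i. convex_on X (g i)"
    and h_convex: "\<And>j. j < nc \<Longrightarrow> convex_on X (h j)"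
    \<comment> \<open>(A3)\<close>
    and Df_lip: "\<And>i. \<exists>L. L-lipschitz_on X (Df i)"
    and Dg_lip: "\<And>i. \<exists>L. L-lipschitz_on X (Dg i)"
    \<comment> \<open>coercivity of \<open>\<theta>\<close> on \<open>\<Xi>\<close>\<close>
    and coercive: "\<And>M. \<exists>R. \<forall>y\<in>Xi. norm y \<ge> R \<longrightarrow> theta y \<ge> M"
    and tau_nonneg: "\<And>i. tau i \<ge> 0"
    and c_tau_pos: "c_tau blk Xs Df tau > 0"
    \<comment> \<open>Algorithm 2\<close>
    and x0: "x 0 \<in> Xi"
    and z_in: "\<And>\<nu>. z \<nu> \<in> Xi"
    and z_acc: "\<And>\<nu>. norm (z \<nu> - xhat Xi (theta_tilde blk f g Df Dg tau) (x \<nu>)) \<le> eps \<nu>"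
    and x_step: "\<And>\<nu>. x (Suc \<nu>) = x \<nu> + gamma \<nu> *\<^sub>R (z \<nu> - x \<nu>)"
    and eps_dec: "decseq eps" and eps_lim: "eps \<longlonglongrightarrow> 0"
    and gamma_range: "\<And>\<nu>. 0 < gamma \<nu> \<and> gamma \<nu> \<le> 1"
    and gamma_lim: "gamma \<longlonglongrightarrow> 0"
    and gamma_div: "\<not> summable gamma"
    and gamma_sq: "summable (\<lambda>\<nu>. (gamma \<nu>)\<^sup>2)"
    and eps_gamma: "summable (\<lambda>\<nu>. eps \<nu> * gamma \<nu>)"
  shows "(\<exists>\<nu>. stationary Xi Dtheta (x \<nu>))
       \<or> ((\<exists>l. seq_limit_point x l) \<and> (\<forall>l. seq_limit_point x l \<longrightarrow> stationary Xi Dtheta l))"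
proof -
  obtain A where A: "\<And>i. (A i)-lipschitz_on X (Df i)" using Df_lip by metis
  obtain B where B: "\<And>i. (B i)-lipschitz_on X (Dg i)" using Dg_lip by metis
  have A0: "0 \<le> A i" and B0: "0 \<le> B i" for i
    using lipschitz_on_nonneg[OF A] lipschitz_on_nonneg[OF B] by auto
  obtain c where c: "c > 0"
    and c_mono: "\<And>i u w y. u \<in> X \<Longrightarrow> w \<in> X \<Longrightarrow> y \<in> X \<Longrightarrow>
      (c - tau i) * (norm (blockproj blk i (u - w)))\<^sup>2
        \<le> (Df i (blend blk i u y) - Df i (blend blk i w y)) \<bullet> blockproj blk i (u - w)"
    using c_tau_pos_imp_strong_monotonicity[OF c_tau_pos] unfolding X_def by blast
  define F where "F = theta_tilde blk f g Df Dg tau"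
  define G where "G = theta_tilde_grad blk Df Dg tau"
  define p where "p = xhat Xi F"
  define K where "K = (\<Sum>i\<in>UNIV. 3 * A i + B i + tau i)"
  define L where "L = (\<Sum>i\<in>UNIV. A i + B i)"
  have L: "0 \<le> L" unfolding L_def by (intro sum_nonneg add_nonneg_nonneg A0 B0)
  have XiX: "Xi \<subseteq> X" by (auto simp: Xi_def X_def Xi_set_def)
  have Xi_convex: "convex Xi"
    unfolding Xi_def by (rule convex_Xi_set[OF Xs_convex h_convex[unfolded X_def]])
  have "continuous_on X (h j)" if "j < nc" for j
    using h_deriv[OF that] X_U by (meson continuous_at_imp_continuous_on has_derivative_continuous subsetD)
  then have Xi_closed: "closed Xi"
    unfolding Xi_def X_def by (intro closed_Xi_set Xs_closed)
  have G_mono: "c * (norm (u - w))\<^sup>2 \<le> (G u y - G w y) \<bullet> (u - w)"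
    if "u \<in> Xi" "w \<in> Xi" "y \<in> Xi" for u w y
    unfolding G_def using c_mono that XiX by (intro theta_tilde_grad_strongly_monotone) blast
  have F_deriv: "((\<lambda>u. F u y) has_derivative (\<lambda>v. G u y \<bullet> v)) (at u)" if "u \<in> Xi" "y \<in> Xi" for u y
    unfolding F_def G_def
  proof (rule theta_tilde_has_derivative)
    \<comment> \<open>A blend of feasible points may violate the coupling constraints, but it stays
      in \<open>X\<close>.\<close>
    have "blend blk i u y \<in> U" for i
      using blend_mem_Xprod[of u blk Xs y i] that XiX X_U unfolding X_def by blast
    then show "(f i has_derivative (\<lambda>v. Df i (blend blk i u y) \<bullet> v)) (at (blend blk i u y))" for i
      by (rule f_deriv)
  qed
  \<comment> \<open>Unique existence makes the description operator in \<open>xhat\<close> denote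
    the actual minimizer.\<close>
  have p_min: "p y \<in> Xi \<and> (\<forall>w\<in>Xi. F (p y) y \<le> F w y)" if y: "y \<in> Xi" for y
    unfolding p_def xhat_def
    by (rule theI', rule strongly_monotone_gradient_ex1_minimizer[OF Xi_convex Xi_closed Xi_ne c,
        where G="\<lambda>u. G u y"]) (use F_deriv G_mono y in auto)
  interpret surrogate_map Xi G p c K
  proof
    show "0 \<le> K" unfolding K_def by (intro sum_nonneg) (simp add: A0 B0 tau_nonneg)
    show "norm (G u y - G u w) \<le> K * norm (y - w)" if "u \<in> Xi" "y \<in> Xi" "w \<in> Xi" for u y w
      unfolding G_def K_def
      by (rule theta_tilde_grad_lipschitz[OF tau_nonneg A[unfolded X_def] B[unfolded X_def]])
        (use that XiX in \<open>auto simp: X_def\<close>)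
    show "p y \<in> Xi" if "y \<in> Xi" for y using p_min[OF that] by blast
    show "0 \<le> G (p y) y \<bullet> (w - p y)" if "y \<in> Xi" "w \<in> Xi" for y w
      by (rule gradient_variational_inequality[where F="\<lambda>u. F u y", OF Xi_convex F_deriv])
        (use p_min that in auto)
  qed (use Xi_convex Xi_closed c G_mono in auto)
  \<comment> \<open>First-order consistency: the surrogate and \<theta> have the same gradient at
    the base point.\<close>
  have G_self: "G y y = Dtheta y" for y by (simp add: G_def Dtheta_def theta_tilde_grad_self)
  have theta_deriv: "(theta has_derivative (\<lambda>v. Dtheta y \<bullet> v)) (at y)" if "y \<in> Xi" for y
    unfolding theta_def Dtheta_def inner_sum_left inner_diff_left
    by (intro has_derivative_sum has_derivative_diff f_deriv g_deriv) (use that XiX X_U in auto)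
  have Dtheta_lip: "norm (Dtheta u - Dtheta w) \<le> L * norm (u - w)" if "u \<in> Xi" "w \<in> Xi" for u w
  proof -
    have uw: "u \<in> X" "w \<in> X" using that XiX by auto
    have "Dtheta u - Dtheta w = (\<Sum>i\<in>UNIV. (Df i u - Df i w) - (Dg i u - Dg i w))"
      by (simp add: Dtheta_def sum_subtractf)
    also have "norm \<dots> \<le> (\<Sum>i\<in>UNIV. A i * norm (u - w) + B i * norm (u - w))"
      by (intro sum_norm_le order_trans[OF norm_triangle_ineq4 add_mono]
          lipschitz_on_normD[OF A uw] lipschitz_on_normD[OF B uw])
    also have "\<dots> = L * norm (u - w)" by (simp add: L_def sum_distrib_right distrib_right)
    finally show ?thesis .
  qed
  have descent: "theta w \<le> theta y + G y y \<bullet> (w - y) + L / 2 * (norm (w - y))\<^sup>2"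
    if "y \<in> Xi" "w \<in> Xi" for y w
  proof -
    \<comment> \<open>The descent inequality is the lower bound for \<open>- theta\<close>, whose
      gradient satisfies the monotonicity condition with constant \<open>- L\<close>.\<close>
    have "- theta y + - Dtheta y \<bullet> (w - y) + - L / 2 * (norm (w - y))\<^sup>2 \<le> - theta w"
    proof (rule lower_bound_of_monotone_gradient[where F="\<lambda>u. - theta u" and G="\<lambda>u. - Dtheta u",
          OF Xi_convex _ _ that])
      show "((\<lambda>u. - theta u) has_derivative (\<lambda>v. - Dtheta u \<bullet> v)) (at u)" if "u \<in> Xi" for u
        using has_derivative_minus[OF theta_deriv[OF that]] by simp
      show "- L * (norm (u - v))\<^sup>2 \<le> (- Dtheta u - - Dtheta v) \<bullet> (u - v)" if "u \<in> Xi" "v \<in> Xi" for u v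
      proof -
        have "(Dtheta u - Dtheta v) \<bullet> (u - v) \<le> norm (Dtheta u - Dtheta v) * norm (u - v)"
          by (rule norm_cauchy_schwarz)
        also have "\<dots> \<le> L * norm (u - v) * norm (u - v)"
          using Dtheta_lip[OF that] by (intro mult_right_mono) auto
        finally show ?thesis by (simp add: power2_eq_square inner_diff_left)
      qed
    qed
    then show ?thesis by (simp add: G_self)
  qed
  have theta_cont: "continuous_on Xi theta"
    using theta_deriv by (meson continuous_at_imp_continuous_on has_derivative_continuous)
  have "0 \<le> L / 2" using L by simp
  note iter = inexact_iteration[OF this descent theta_cont coercive x0 z_in
      z_acc[folded F_def p_def] x_step eps_lim gamma_range gamma_lim gamma_div eps_gamma]
  obtain l r where "strict_mono r" "(x \<circ> r) \<longlonglongrightarrow> l"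
    using bounded_imp_convergent_subsequence[OF iter(2)] by blast
  then have "\<exists>l. seq_limit_point x l" by (auto simp: seq_limit_point_def)
  \<comment> \<open>At a fixed point \<open>l\<close> of \<open>p\<close> the variational inequality
    involves \<open>G l l\<close>, hence is stationarity itself. The second alternative is thus
    obtained without a case split on the iterates.\<close>
  moreover have "stationary Xi Dtheta l" if "seq_limit_point x l" for l
    using limit_point_fixed[OF iter(1,3) that] p_vi[of l] by (simp add: stationary_def G_self)
  ultimately show ?thesis by blast
qed

end
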